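(* Let $\mu>0$, $1\le p\le\infty$, $a<b$ and $s\ge c$ in $\mathbb{R}$, and let $\Psi\in C^1([a,b])$ be a positive increasing function with $\Psi'(x)\neq0$ for all $x\in[a,b]$. Then the operator ${}^{H}_{a}I^{\mu,s}_{\Psi(x)}$ is bounded in the space $X^{p}_{\Psi,c}(a,b)$ and $$\left\|{}^{H}_{a}I^{\mu,s}_{\Psi(x)}f\right\|_{X^{p}_{\Psi,c}}\le K\|f\|_{X^{p}_{\Psi,c}},$$ where the constant $K$ is defined by $$K=\begin{cases}\dfrac{1}{\Gamma(\mu+1)}\left(\log\dfrac{\Psi(b)}{\Psi(a)}\right)^{\mu}&\text{for }s=c,\\[2ex]\dfrac{1}{\Gamma(\mu)}(s-c)^{-\mu}\,\gamma\left(\mu,(s-c)\log\dfrac{\Psi(b)}{\Psi(a)}\right)&\text{for }s>c.\end{cases}$$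
   Context: For $c\in\mathbb{R}$ and $1\le p\le\infty$, $X^{p}_{\Psi,c}(a,b)$ is the space of all Lebesgue measurable $f:[a,b]\to\mathbb{C}$ with $\|f\|_{X^{p}_{\Psi,c}}<\infty$, where $$\|f\|_{X^{p}_{\Psi,c}}=\left(\int_a^b\left|\Psi(x)^{c}f(x)\right|^p\frac{\Psi'(x)}{\Psi(x)}\,dx\right)^{1/p}\ (1\le p<\infty),\qquad \|f\|_{X^{\infty}_{\Psi,c}}=\operatorname*{ess\,sup}_{a\le x\le b}\left(\Psi(x)^{c}|f(x)|\right).$$ The Hadamard-type fractional integral with respect to $\Psi$ of order $\mu>0$ and parameter $s$ is $${}^{H}_{a}I^{\mu,s}_{\Psi(x)}f(x)=\frac{1}{\Gamma(\mu)}\int_{a}^{x}\left(\frac{\Psi(t)}{\Psi(x)}\right)^{s}\left(\log\frac{\Psi(x)}{\Psi(t)}\right)^{\mu-1}f(t)\frac{\Psi'(t)}{\Psi(t)}\,dt.$$ $\gamma(\mu,y)=\int_0^y e^{-t}t^{\mu-1}\,dt$ is the lower incomplete Gamma function. *)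

theory Defs
  imports "HOL-Analysis.Analysis" "HOL-Probability.Essential_Supremum"
begin

text \<open>Derivatives of functions on \<open>[a,b]\<close> are one-sided at the end points. The library's
  \<^const>\<open>C1_differentiable_on\<close> asks for two-sided derivatives there, that is, for conditions on
  the function outside \<open>[a,b]\<close>.\<close>

definition C1_on_interval :: "real \<Rightarrow> real \<Rightarrow> (real \<Rightarrow> real) \<Rightarrow> bool" where
  "C1_on_interval a b \<Psi> \<longleftrightarrow>
     (\<exists>D. (\<forall>x\<in>{a..b}. (\<Psi> has_real_derivative D x) (at x within {a..b})) \<and> continuous_on {a..b} D)"

definition deriv_on :: "real \<Rightarrow> real \<Rightarrow> (real \<Rightarrow> real) \<Rightarrow> real \<Rightarrow> real" where
  "deriv_on a b \<Psi> x = vector_derivative \<Psi> (at x within {a..b})"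

text \<open>The exponent \<open>p\<close> ranges over \<open>[1,\<infinity>]\<close>. The norm takes values in \<open>[0,\<infinity>]\<close>; there is no
  \<open>powr\<close> on \<^typ>\<open>ennreal\<close>, so the \<open>p\<close>-th root of \<open>\<infinity>\<close> is set to \<open>\<infinity>\<close> explicitly.\<close>

definition X_norm ::
  "(real \<Rightarrow> real) \<Rightarrow> real \<Rightarrow> ennreal \<Rightarrow> real \<Rightarrow> real \<Rightarrow> (real \<Rightarrow> complex) \<Rightarrow> ennreal" where
  "X_norm \<Psi> c p a b f =
     (if p = \<infinity> then
        esssup (lebesgue_on {a..b}) (\<lambda>x. ennreal (\<Psi> x powr c * cmod (f x)))
      else
        let J = (\<integral>\<^sup>+x. ennreal (cmod (complex_of_real (\<Psi> x powr c) * f x) powr enn2real p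
                            * (deriv_on a b \<Psi> x / \<Psi> x)) \<partial>lebesgue_on {a..b})
        in if J = \<infinity> then \<infinity> else ennreal (enn2real J powr (1 / enn2real p)))"

definition X_space ::
  "(real \<Rightarrow> real) \<Rightarrow> real \<Rightarrow> ennreal \<Rightarrow> real \<Rightarrow> real \<Rightarrow> (real \<Rightarrow> complex) set" where
  "X_space \<Psi> c p a b = {f \<in> borel_measurable (lebesgue_on {a..b}). X_norm \<Psi> c p a b f < \<infinity>}"

text \<open>The end point \<open>b\<close> is a parameter here only because the derivative of \<open>\<Psi>\<close> is taken
  within \<open>[a,b]\<close>. At the single point \<open>t = x\<close> the kernel has the conventional value \<open>0\<close>.\<close>

definition hadamard_integrand ::
  "(real \<Rightarrow> real) \<Rightarrow> real \<Rightarrow> real \<Rightarrow> real \<Rightarrow> real \<Rightarrow> (real \<Rightarrow> complex) \<Rightarrow> real \<Rightarrow> real \<Rightarrow> complex" where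
  "hadamard_integrand \<Psi> a b \<mu> s f x t =
     complex_of_real ((\<Psi> t / \<Psi> x) powr s * ln (\<Psi> x / \<Psi> t) powr (\<mu> - 1))
       * f t * complex_of_real (deriv_on a b \<Psi> t / \<Psi> t)"

definition hadamard_integral ::
  "(real \<Rightarrow> real) \<Rightarrow> real \<Rightarrow> real \<Rightarrow> real \<Rightarrow> real \<Rightarrow> (real \<Rightarrow> complex) \<Rightarrow> real \<Rightarrow> complex" where
  "hadamard_integral \<Psi> a b \<mu> s f x =
     complex_of_real (1 / Gamma \<mu>) *
       (LINT t|lebesgue_on {a..x}. hadamard_integrand \<Psi> a b \<mu> s f x t)"

definition lower_incomplete_Gamma :: "real \<Rightarrow> real \<Rightarrow> real" where
  "lower_incomplete_Gamma \<mu> y = (LINT t|lebesgue_on {0..y}. exp (- t) * t powr (\<mu> - 1))"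

definition hadamard_const ::
  "(real \<Rightarrow> real) \<Rightarrow> real \<Rightarrow> real \<Rightarrow> real \<Rightarrow> real \<Rightarrow> real \<Rightarrow> real" where
  "hadamard_const \<Psi> a b \<mu> s c =
     (if s = c then 1 / Gamma (\<mu> + 1) * ln (\<Psi> b / \<Psi> a) powr \<mu>
      else 1 / Gamma \<mu> * (s - c) powr (- \<mu>)
             * lower_incomplete_Gamma \<mu> ((s - c) * ln (\<Psi> b / \<Psi> a)))"

end

theory Submission
  imports Defs
begin

text \<open>In the coordinate \<open>\<phi> = ln \<circ> \<Psi>\<close> the measure \<open>\<Psi>'(x)/\<Psi>(x) dx\<close> becomes Lebesgue measure, and the
  weighted modulus \<open>\<Psi>(x)\<^sup>c \<bar>I f(x)\<bar>\<close> of the Hadamard-type integral is dominated by \<open>1/\<Gamma>(\<mu>)\<close> times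
  the one-sided convolution of \<open>F = \<Psi>\<^sup>c \<bar>f\<bar>\<close> with \<open>h(u) = exp(-(s-c)u) u powr (\<mu>-1)\<close>: the factor
  \<open>(\<Psi>(t)/\<Psi>(x))\<^sup>s\<close> and the two weights \<open>\<Psi>(x)\<^sup>c\<close> and \<open>\<Psi>(t)\<^sup>-\<^sup>c\<close> combine into the exponential. Since
  \<open>\<phi>(x) - \<phi>(t)\<close> stays in \<open>[0,L]\<close> with \<open>L = ln (\<Psi>(b)/\<Psi>(a))\<close>, only the mass \<open>C\<close> of \<open>h\<close> on
  \<open>[0,L]\<close> matters, and \<open>C/\<Gamma>(\<mu>)\<close> is the constant of the theorem
  (\<open>hadamard_const_eq_kernel_mass\<close>).

  Instead of Young's convolution inequality on the multiplicative group, the proof applies the Schur test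
  (\<open>schur_test\<close>) on \<open>[a,b]\<close> itself, with the measure \<open>\<Psi>'/\<Psi> dx\<close>. Substituting
  \<open>u = \<phi>(x) - \<phi>(t)\<close> in either variable shows that both marginals of the kernel are at most \<open>C\<close>
  (\<open>convolution_kernel_row\<close>, \<open>convolution_kernel_column\<close>), so the convolution maps \<open>L\<^sup>q\<close> to itself with
  norm at most \<open>C\<close>. Finiteness almost everywhere of the integral of absolute values is part of the Schur
  test and gives the existence of the Hadamard integral. For the exponent \<open>\<infinity>\<close> the bound follows directly from
  the mass of the rows.\<close>

section \<open>The Schur test\<close>

text \<open>The graph of the convex function \<open>y powr q\<close> lies above its tangent at \<open>l\<close>.\<close>

lemma powr_tangent:
  fixes y l q :: real
  assumes "1 \<le> q" "0 \<le> y" "0 < l"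
  shows "q * l powr (q - 1) * y \<le> y powr q + (q - 1) * l powr q"
proof (cases "y = 0")
  case True
  then show ?thesis using assms by simp
next
  case False
  then have "0 < y" using assms by simp
  have "(y powr q) powr (1 / q) * (l powr q) powr (1 - 1 / q)
      \<le> 1 / q * y powr q + (1 - 1 / q) * l powr q"
    using assms \<open>0 < y\<close> by (intro Youngs_inequality_0) auto
  moreover have "(y powr q) powr (1 / q) = y" "(l powr q) powr (1 - 1 / q) = l powr (q - 1)"
    using assms \<open>0 < y\<close> by (auto simp: powr_powr right_diff_distrib)
  ultimately have "q * (y * l powr (q - 1)) \<le> q * (1 / q * y powr q + (1 - 1 / q) * l powr q)"
    using assms by (intro mult_left_mono) auto
  also have "\<dots> = y powr q + (q - 1) * l powr q"
    using assms by (simp add: field_simps)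
  finally show ?thesis by (simp add: mult_ac)
qed

text \<open>Jensen's inequality for \<open>y powr q\<close>, with \<open>k dN\<close> in the role of the probability measure, although its
  mass is only known to be at most \<open>C\<close>. Integrating the tangent inequality against \<open>k dN\<close> bounds the integral
  of \<open>F\<close> by that of \<open>F powr q\<close> plus a constant; this already shows that it is finite, and the
  point of tangency can then be chosen optimally.\<close>

lemma weighted_jensen_powr:
  fixes k :: "'a \<Rightarrow> ennreal" and F :: "'a \<Rightarrow> real" and C q :: real
  assumes [measurable]: "k \<in> borel_measurable N" "F \<in> borel_measurable N"
    and F: "\<And>t. 0 \<le> F t" and q: "1 \<le> q" and C: "0 < C"
    and k: "(\<integral>\<^sup>+t. k t \<partial>N) \<le> ennreal C"
    and fin: "(\<integral>\<^sup>+t. k t * ennreal (F t powr q) \<partial>N) < \<infinity>"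
  shows "(\<integral>\<^sup>+t. k t * ennreal (F t) \<partial>N) < \<infinity>"
    and "ennreal (enn2real (\<integral>\<^sup>+t. k t * ennreal (F t) \<partial>N) powr q)
      \<le> ennreal (C powr (q - 1)) * (\<integral>\<^sup>+t. k t * ennreal (F t powr q) \<partial>N)"
proof -
  define S where "S = (\<integral>\<^sup>+t. k t * ennreal (F t) \<partial>N)"
  define Q where "Q = (\<integral>\<^sup>+t. k t * ennreal (F t powr q) \<partial>N)"
  have tangent: "ennreal (q * l powr (q - 1)) * S \<le> Q + ennreal ((q - 1) * l powr q * C)"
    if l: "0 < l" for l :: real
  proof -
    have "ennreal (q * l powr (q - 1)) * S
        = (\<integral>\<^sup>+t. k t * ennreal (q * l powr (q - 1) * F t) \<partial>N)"
      unfolding S_def using q F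
      by (subst nn_integral_cmult[symmetric])
         (auto intro!: nn_integral_cong simp: ennreal_mult mult_ac)
    also have "\<dots> \<le> (\<integral>\<^sup>+t. k t * ennreal (F t powr q) + ennreal ((q - 1) * l powr q) * k t \<partial>N)"
    proof (intro nn_integral_mono)
      fix t
      have "k t * ennreal (q * l powr (q - 1) * F t)
          \<le> k t * ennreal (F t powr q + (q - 1) * l powr q)"
        using powr_tangent[OF q F l] by (intro mult_left_mono ennreal_leI) auto
      also have "\<dots> = k t * ennreal (F t powr q) + ennreal ((q - 1) * l powr q) * k t"
        using q by (simp add: ennreal_plus distrib_left mult.commute)
      finally show "k t * ennreal (q * l powr (q - 1) * F t) \<le> \<dots>" .
    qed
    also have "\<dots> = Q + ennreal ((q - 1) * l powr q) * (\<integral>\<^sup>+t. k t \<partial>N)"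
      unfolding Q_def by (simp add: nn_integral_add nn_integral_cmult)
    also have "\<dots> \<le> Q + ennreal ((q - 1) * l powr q) * ennreal C"
      using k by (intro add_left_mono mult_left_mono) auto
    finally show ?thesis
      using q C by (simp add: ennreal_mult)
  qed
  have "Q < \<infinity>" using fin by (simp add: Q_def)
  \<comment> \<open>Tangency at \<open>1\<close> suffices for finiteness.\<close>
  have "ennreal q * S \<le> Q + ennreal ((q - 1) * C)"
    using tangent[of 1] by simp
  also have "\<dots> < \<infinity>" using \<open>Q < \<infinity>\<close> by (simp add: ennreal_add_less_top)
  finally have "ennreal q * S < \<infinity>" .
  then have "S < \<infinity>"
    using q by (auto simp: ennreal_mult_less_top ennreal_eq_0_iff)
  then show "(\<integral>\<^sup>+t. k t * ennreal (F t) \<partial>N) < \<infinity>" by (simp add: S_def)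
  obtain r where r: "S = ennreal r" "0 \<le> r"
    using \<open>S < \<infinity>\<close> by (cases S) auto
  obtain v where v: "Q = ennreal v" "0 \<le> v"
    using \<open>Q < \<infinity>\<close> by (cases Q) auto
  have "r powr q \<le> C powr (q - 1) * v"
  proof (cases "r = 0")
    case True
    then show ?thesis using v by simp
  next
    case False
    then have "0 < r" using r by simp
    \<comment> \<open>If the mass of \<open>k\<close> is \<open>C\<close>, then \<open>r / C\<close> is the mean of \<open>F\<close>, where Jensen's inequality is sharp.\<close>
    have "ennreal (q * (r / C) powr (q - 1) * r) \<le> ennreal (v + (q - 1) * (r / C) powr q * C)"
      using tangent[of "r / C"] \<open>0 < r\<close> C q r v
      by (simp add: ennreal_plus ennreal_mult)
    then have "q * (r / C) powr (q - 1) * r \<le> v + (q - 1) * (r / C) powr q * C"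
      using q C v by (subst (asm) ennreal_le_iff) auto
    moreover have "(r / C) powr q * C = (r / C) powr (q - 1) * r"
      using \<open>0 < r\<close> C by (simp add: powr_diff)
    ultimately have "q * ((r / C) powr (q - 1) * r) \<le> v + (q - 1) * ((r / C) powr (q - 1) * r)"
      by (simp add: mult.assoc)
    then have "(r / C) powr (q - 1) * r \<le> v"
      by (simp add: left_diff_distrib)
    moreover have "r powr q = C powr (q - 1) * ((r / C) powr (q - 1) * r)"
      using \<open>0 < r\<close> C by (simp add: powr_divide powr_diff)
    ultimately show ?thesis
      by (simp add: mult_left_mono)
  qed
  then show "ennreal (enn2real (\<integral>\<^sup>+t. k t * ennreal (F t) \<partial>N) powr q)
      \<le> ennreal (C powr (q - 1)) * (\<integral>\<^sup>+t. k t * ennreal (F t powr q) \<partial>N)"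
    using r v by (simp add: S_def[symmetric] Q_def[symmetric] ennreal_mult[symmetric])
qed

text \<open>The Schur test with constant weights. The bound on the rows lets Jensen's inequality replace the
  \<open>q\<close>-th power of the integral of \<open>F\<close> by the integral \<open>Q x\<close> of \<open>F powr q\<close>, at the cost of \<open>C powr (q - 1)\<close>;
  after exchanging the order of integration, the bound on the columns controls the integral of
  \<open>Q\<close> and contributes the last factor \<open>C\<close>.\<close>

lemma (in pair_sigma_finite) schur_test:
  fixes k :: "'a \<Rightarrow> 'b \<Rightarrow> ennreal" and F :: "'b \<Rightarrow> real" and C q :: real
  assumes k[measurable]: "case_prod k \<in> borel_measurable (M1 \<Otimes>\<^sub>M M2)"
    and F[measurable]: "F \<in> borel_measurable M2"
    and F0: "\<And>t. 0 \<le> F t" and q: "1 \<le> q" and C: "0 < C"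
    and row: "\<And>x. x \<in> space M1 \<Longrightarrow> (\<integral>\<^sup>+t. k x t \<partial>M2) \<le> ennreal C"
    and col: "\<And>t. t \<in> space M2 \<Longrightarrow> (\<integral>\<^sup>+x. k x t \<partial>M1) \<le> ennreal C"
    and fin: "(\<integral>\<^sup>+t. ennreal (F t powr q) \<partial>M2) < \<infinity>"
  shows "AE x in M1. (\<integral>\<^sup>+t. k x t * ennreal (F t) \<partial>M2) < \<infinity>"
    and "(\<integral>\<^sup>+x. ennreal (enn2real (\<integral>\<^sup>+t. k x t * ennreal (F t) \<partial>M2) powr q) \<partial>M1)
      \<le> ennreal (C powr q) * (\<integral>\<^sup>+t. ennreal (F t powr q) \<partial>M2)"
proof -
  define Q where "Q x = (\<integral>\<^sup>+t. k x t * ennreal (F t powr q) \<partial>M2)" for x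
  have Q[measurable]: "Q \<in> borel_measurable M1"
    unfolding Q_def by measurable
  have "(\<integral>\<^sup>+x. Q x \<partial>M1) = (\<integral>\<^sup>+t. (\<integral>\<^sup>+x. k x t * ennreal (F t powr q) \<partial>M1) \<partial>M2)"
    unfolding Q_def by (rule Fubini'[symmetric]) measurable
  also have "\<dots> = (\<integral>\<^sup>+t. (\<integral>\<^sup>+x. k x t \<partial>M1) * ennreal (F t powr q) \<partial>M2)"
    by (intro nn_integral_cong nn_integral_multc) measurable
  also have "\<dots> \<le> (\<integral>\<^sup>+t. ennreal C * ennreal (F t powr q) \<partial>M2)"
    using col by (intro nn_integral_mono mult_right_mono) auto
  also have "\<dots> = ennreal C * (\<integral>\<^sup>+t. ennreal (F t powr q) \<partial>M2)"
    by (intro nn_integral_cmult) measurable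
  finally have Q_le: "(\<integral>\<^sup>+x. Q x \<partial>M1) \<le> ennreal C * (\<integral>\<^sup>+t. ennreal (F t powr q) \<partial>M2)" .
  also have "\<dots> < \<infinity>" using fin by (simp add: ennreal_mult_less_top)
  finally have AE_Q: "AE x in M1. Q x < \<infinity>"
    using nn_integral_noteq_infinite[OF Q] by (simp add: less_top)
  have jensen: "(\<integral>\<^sup>+t. k x t * ennreal (F t) \<partial>M2) < \<infinity> \<and>
      ennreal (enn2real (\<integral>\<^sup>+t. k x t * ennreal (F t) \<partial>M2) powr q) \<le> ennreal (C powr (q - 1)) * Q x"
    if x: "x \<in> space M1" "Q x < \<infinity>" for x
  proof -
    have "k x \<in> borel_measurable M2" using x(1) by measurable
    then show ?thesis
      using weighted_jensen_powr[OF _ F F0 q C row[OF x(1)]] x(2) by (simp add: Q_def)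
  qed
  show "AE x in M1. (\<integral>\<^sup>+t. k x t * ennreal (F t) \<partial>M2) < \<infinity>"
    using AE_Q by (rule AE_mp) (intro AE_I2 impI, use jensen in blast)
  have "(\<integral>\<^sup>+x. ennreal (enn2real (\<integral>\<^sup>+t. k x t * ennreal (F t) \<partial>M2) powr q) \<partial>M1)
      \<le> (\<integral>\<^sup>+x. ennreal (C powr (q - 1)) * Q x \<partial>M1)"
    by (rule nn_integral_mono_AE, rule AE_mp[OF AE_Q])
       (intro AE_I2 impI, use jensen in blast)
  also have "\<dots> = ennreal (C powr (q - 1)) * (\<integral>\<^sup>+x. Q x \<partial>M1)"
    by (intro nn_integral_cmult) measurable
  also have "\<dots> \<le> ennreal (C powr (q - 1)) * (ennreal C * (\<integral>\<^sup>+t. ennreal (F t powr q) \<partial>M2))"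
    using Q_le by (intro mult_left_mono) auto
  also have "\<dots> = ennreal (C powr q) * (\<integral>\<^sup>+t. ennreal (F t powr q) \<partial>M2)"
    using C by (simp add: mult.assoc[symmetric] ennreal_mult[symmetric] powr_diff)
  finally show "(\<integral>\<^sup>+x. ennreal (enn2real (\<integral>\<^sup>+t. k x t * ennreal (F t) \<partial>M2) powr q) \<partial>M1)
      \<le> ennreal (C powr q) * (\<integral>\<^sup>+t. ennreal (F t powr q) \<partial>M2)" .
qed

section \<open>Substitution in Lebesgue integrals\<close>

text \<open>Since the derivatives are taken within \<open>S\<close>, this applies up to the end points of a closed interval.\<close>

lemma integral_substitution_lebesgue_on:
  fixes f g g' :: "real \<Rightarrow> real"
  assumes S: "S \<in> sets lebesgue" and gS: "g ` S \<in> sets lebesgue"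
    and der: "\<And>x. x \<in> S \<Longrightarrow> (g has_real_derivative g' x) (at x within S)"
    and inj: "inj_on g S"
    and f: "integrable (lebesgue_on (g ` S)) f"
  shows "integrable (lebesgue_on S) (\<lambda>x. \<bar>g' x\<bar> * f (g x))"
    and "(LINT x|lebesgue_on S. \<bar>g' x\<bar> * f (g x)) = (LINT v|lebesgue_on (g ` S). f v)"
proof -
  have abs: "f absolutely_integrable_on g ` S"
    using f gS by (simp add: set_integrable_def integrable_restrict_space)
  have *: "(\<lambda>x. \<bar>g' x\<bar> * f (g x)) absolutely_integrable_on S \<and>
      integral S (\<lambda>x. \<bar>g' x\<bar> * f (g x)) = integral (g ` S) f"
    using has_absolute_integral_change_of_variables_1'[OF S der inj] abs by blast
  then show int: "integrable (lebesgue_on S) (\<lambda>x. \<bar>g' x\<bar> * f (g x))"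
    using S by (simp add: set_integrable_def integrable_restrict_space)
  show "(LINT x|lebesgue_on S. \<bar>g' x\<bar> * f (g x)) = (LINT v|lebesgue_on (g ` S). f v)"
    using * by (simp add: lebesgue_integral_eq_integral[OF int S] lebesgue_integral_eq_integral[OF f gS])
qed

section \<open>The mass of the kernel\<close>

definition exp_powr_kernel :: "real \<Rightarrow> real \<Rightarrow> real \<Rightarrow> real" where
  "exp_powr_kernel \<sigma> \<mu> u = exp (- (\<sigma> * u)) * u powr (\<mu> - 1)"

definition kernel_mass :: "real \<Rightarrow> real \<Rightarrow> real \<Rightarrow> real" where
  "kernel_mass \<sigma> \<mu> L = (LINT u|lebesgue_on {0..L}. exp_powr_kernel \<sigma> \<mu> u)"

lemma exp_powr_kernel_nonneg [simp]: "0 \<le> exp_powr_kernel \<sigma> \<mu> u"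
  by (simp add: exp_powr_kernel_def)

lemma exp_powr_kernel_measurable [measurable]: "exp_powr_kernel \<sigma> \<mu> \<in> borel_measurable borel"
  unfolding exp_powr_kernel_def by measurable

lemma borel_measurable_lebesgue_on_borel:
  assumes [measurable]: "f \<in> borel_measurable borel"
  shows "f \<in> borel_measurable (lebesgue_on S)"
  using assms by (intro measurable_restrict_space1 measurable_completion) simp

lemma powr_integral_from_0:
  fixes \<mu> L :: real
  assumes "0 < \<mu>" "0 \<le> L"
  shows "integrable (lebesgue_on {0..L}) (\<lambda>u. u powr (\<mu> - 1))"
    and "(LINT u|lebesgue_on {0..L}. u powr (\<mu> - 1)) = L powr \<mu> / \<mu>"
proof -
  have *: "((\<lambda>u. u powr (\<mu> - 1)) has_integral L powr \<mu> / \<mu>) {0..L}"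
    using has_integral_powr_from_0[of "\<mu> - 1" L] assms by simp
  then have "(\<lambda>u. u powr (\<mu> - 1)) absolutely_integrable_on {0..L}"
    by (intro nonnegative_absolutely_integrable_1) auto
  then show int: "integrable (lebesgue_on {0..L}) (\<lambda>u. u powr (\<mu> - 1))"
    by (simp add: set_integrable_def integrable_restrict_space)
  show "(LINT u|lebesgue_on {0..L}. u powr (\<mu> - 1)) = L powr \<mu> / \<mu>"
    using integral_unique[OF *] by (simp add: lebesgue_integral_eq_integral[OF int])
qed

lemma exp_powr_kernel_integrable:
  assumes "0 < \<mu>" "0 \<le> \<sigma>" "0 \<le> L"
  shows "integrable (lebesgue_on {0..L}) (exp_powr_kernel \<sigma> \<mu>)"
proof (rule Bochner_Integration.integrable_bound)
  show "integrable (lebesgue_on {0..L}) (\<lambda>u. u powr (\<mu> - 1))"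
    using assms by (intro powr_integral_from_0)
  show "exp_powr_kernel \<sigma> \<mu> \<in> borel_measurable (lebesgue_on {0..L})"
    by (intro borel_measurable_lebesgue_on_borel exp_powr_kernel_measurable)
  show "AE u in lebesgue_on {0..L}. norm (exp_powr_kernel \<sigma> \<mu> u) \<le> norm (u powr (\<mu> - 1))"
    using assms by (intro AE_I2) (auto simp: exp_powr_kernel_def intro!: mult_left_le_one_le)
qed

text \<open>The lower bound \<open>exp (- (\<sigma> * L))\<close> of the exponential factor leaves a multiple of the explicitly known
  integral of \<open>u powr (\<mu> - 1)\<close>.\<close>

lemma kernel_mass_pos:
  assumes "0 < \<mu>" "0 \<le> \<sigma>" "0 < L"
  shows "0 < kernel_mass \<sigma> \<mu> L"
proof -
  have "0 < exp (- (\<sigma> * L)) * (L powr \<mu> / \<mu>)"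
    using assms by simp
  also have "\<dots> = (LINT u|lebesgue_on {0..L}. exp (- (\<sigma> * L)) * u powr (\<mu> - 1))"
    using assms powr_integral_from_0[of \<mu> L] by simp
  also have "\<dots> \<le> kernel_mass \<sigma> \<mu> L"
    unfolding kernel_mass_def
  proof (rule integral_mono)
    show "integrable (lebesgue_on {0..L}) (\<lambda>u. exp (- (\<sigma> * L)) * u powr (\<mu> - 1))"
      using assms powr_integral_from_0[of \<mu> L] by simp
    show "integrable (lebesgue_on {0..L}) (exp_powr_kernel \<sigma> \<mu>)"
      using assms by (intro exp_powr_kernel_integrable) auto
    show "exp (- (\<sigma> * L)) * u powr (\<mu> - 1) \<le> exp_powr_kernel \<sigma> \<mu> u"
      if "u \<in> space (lebesgue_on {0..L})" for u
      using assms that by (auto simp: exp_powr_kernel_def intro!: mult_right_mono mult_left_mono)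
  qed
  finally show ?thesis .
qed

lemma kernel_mass_mono:
  assumes "0 < \<mu>" "0 \<le> \<sigma>" "0 \<le> l" "l \<le> L"
  shows "kernel_mass \<sigma> \<mu> l \<le> kernel_mass \<sigma> \<mu> L"
proof -
  have int: "integrable (lebesgue_on {0..r}) (exp_powr_kernel \<sigma> \<mu>)" if "0 \<le> r" for r
    using assms that by (intro exp_powr_kernel_integrable)
  have "exp_powr_kernel \<sigma> \<mu> integrable_on {0..r}" if "0 \<le> r" for r
    by (intro integrable_on_lebesgue_on[OF int[OF that]]) simp
  then show ?thesis
    using assms unfolding kernel_mass_def
    by (simp add: lebesgue_integral_eq_integral[OF int] integral_subset_le)
qed

lemma kernel_mass_zero_rate:
  assumes "0 < \<mu>" "0 \<le> L"
  shows "kernel_mass 0 \<mu> L = L powr \<mu> / \<mu>"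
  using powr_integral_from_0[OF assms] by (simp add: kernel_mass_def exp_powr_kernel_def)

text \<open>The substitution \<open>v = \<sigma> * u\<close>.\<close>

lemma kernel_mass_pos_rate:
  assumes "0 < \<mu>" "0 < \<sigma>" "0 \<le> L"
  shows "kernel_mass \<sigma> \<mu> L = \<sigma> powr (- \<mu>) * lower_incomplete_Gamma \<mu> (\<sigma> * L)"
proof -
  have img: "(\<lambda>u. \<sigma> * u) ` {0..L} = {0..\<sigma> * L}"
    using assms by (simp add: image_mult_atLeastAtMost)
  have "lower_incomplete_Gamma \<mu> (\<sigma> * L) = (LINT v|lebesgue_on {0..\<sigma> * L}. exp_powr_kernel 1 \<mu> v)"
    by (simp add: lower_incomplete_Gamma_def exp_powr_kernel_def)
  also have "\<dots> = (LINT u|lebesgue_on {0..L}. \<bar>\<sigma>\<bar> * exp_powr_kernel 1 \<mu> (\<sigma> * u))"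
    unfolding img[symmetric] using assms
    by (intro integral_substitution_lebesgue_on(2)[symmetric] exp_powr_kernel_integrable)
       (auto simp: img intro!: derivative_eq_intros inj_onI exp_powr_kernel_integrable)
  also have "\<dots> = (LINT u|lebesgue_on {0..L}. \<sigma> powr \<mu> * exp_powr_kernel \<sigma> \<mu> u)"
    using assms
    by (intro Bochner_Integration.integral_cong)
       (auto simp: exp_powr_kernel_def powr_mult powr_diff)
  also have "\<dots> = \<sigma> powr \<mu> * kernel_mass \<sigma> \<mu> L"
    by (simp add: kernel_mass_def)
  finally show ?thesis
    using assms by (simp add: powr_minus)
qed

lemma hadamard_const_eq_kernel_mass:
  assumes "0 < \<mu>" "c \<le> s" "1 \<le> \<Psi> b / \<Psi> a"
  shows "hadamard_const \<Psi> a b \<mu> s c = kernel_mass (s - c) \<mu> (ln (\<Psi> b / \<Psi> a)) / Gamma \<mu>"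
proof (cases "s = c")
  case True
  have "Gamma (\<mu> + 1) = \<mu> * Gamma \<mu>"
    using assms by (intro Gamma_plus1) (auto elim!: nonpos_Ints_cases)
  then show ?thesis
    using assms True by (simp add: hadamard_const_def kernel_mass_zero_rate)
next
  case False
  then show ?thesis
    using assms by (simp add: hadamard_const_def kernel_mass_pos_rate)
qed

section \<open>The measure of an increasing coordinate\<close>

lemma nn_integral_lebesgue_on_subset:
  assumes "S \<in> sets lebesgue" "T \<in> sets lebesgue" "S \<subseteq> T"
  shows "(\<integral>\<^sup>+t. f t \<partial>lebesgue_on S) = (\<integral>\<^sup>+t. f t * indicator S t \<partial>lebesgue_on T)"
  using assms
  by (simp add: nn_integral_restrict_space mult.assoc indicator_inter_arith[symmetric] Int_absorb2 Int_absorb1)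

text \<open>The case of interest is \<open>\<phi> = ln \<circ> \<Psi>\<close> and \<open>w = \<Psi>'/\<Psi>\<close>.\<close>

locale increasing_coordinate =
  fixes \<phi> w :: "real \<Rightarrow> real" and a b :: real
  assumes less: "a < b"
    and deriv: "\<And>x. x \<in> {a..b} \<Longrightarrow> (\<phi> has_real_derivative w x) (at x within {a..b})"
    and weight_continuous: "continuous_on {a..b} w"
    and weight_pos: "\<And>x. x \<in> {a..b} \<Longrightarrow> 0 < w x"
begin

lemma coordinate_continuous: "continuous_on {a..b} \<phi>"
  using deriv by (intro DERIV_continuous_on)

lemma coordinate_less:
  assumes "x \<in> {a..b}" "y \<in> {a..b}" "x < y"
  shows "\<phi> x < \<phi> y"
proof (rule DERIV_pos_imp_increasing_open[OF \<open>x < y\<close>])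
  show "\<exists>d. (\<phi> has_real_derivative d) (at z) \<and> 0 < d" if "x < z" "z < y" for z
    using deriv[of z] weight_pos[of z] that assms at_within_Icc_at[of a z b] by auto
  show "continuous_on {x..y} \<phi>"
    using assms by (intro continuous_on_subset[OF coordinate_continuous]) auto
qed

lemma coordinate_le_iff:
  assumes "x \<in> {a..b}" "y \<in> {a..b}"
  shows "\<phi> x \<le> \<phi> y \<longleftrightarrow> x \<le> y"
  using coordinate_less[OF assms] coordinate_less[OF assms(2,1)]
  by (cases x y rule: linorder_cases) auto

lemma coordinate_inj: "inj_on \<phi> {a..b}"
  by (intro inj_onI) (metis coordinate_le_iff order_antisym order_refl)

lemma coordinate_image:
  assumes "x \<in> {a..b}" "y \<in> {a..b}" "x \<le> y"
  shows "\<phi> ` {x..y} = {\<phi> x..\<phi> y}"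
proof
  show "\<phi> ` {x..y} \<subseteq> {\<phi> x..\<phi> y}"
    using assms by (auto simp: coordinate_le_iff)
  show "{\<phi> x..\<phi> y} \<subseteq> \<phi> ` {x..y}"
  proof
    fix v assume "v \<in> {\<phi> x..\<phi> y}"
    moreover have "continuous_on {x..y} \<phi>"
      using assms by (intro continuous_on_subset[OF coordinate_continuous]) auto
    ultimately show "v \<in> \<phi> ` {x..y}"
      using IVT'[of \<phi> x v y] assms(3) by auto
  qed
qed

text \<open>The measure that \<open>\<phi>\<close> carries to Lebesgue measure on \<open>[\<phi>(a), \<phi>(b)]\<close>. Working with it on \<open>[a,b]\<close>
  avoids transporting the functions themselves through \<open>\<phi>\<close>.\<close>

definition \<nu> :: "real measure" where
  "\<nu> = density (lebesgue_on {a..b}) (\<lambda>x. ennreal (w x))"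

lemma weight_measurable [measurable]: "w \<in> borel_measurable (lebesgue_on {a..b})"
  by (intro continuous_imp_measurable_on_sets_lebesgue weight_continuous) simp

lemma coordinate_measurable [measurable]: "\<phi> \<in> borel_measurable (lebesgue_on {a..b})"
  by (intro continuous_imp_measurable_on_sets_lebesgue coordinate_continuous) simp

lemma sets_\<nu> [measurable_cong, simp]: "sets \<nu> = sets (lebesgue_on {a..b})"
  by (simp add: \<nu>_def)

lemma space_\<nu> [simp]: "space \<nu> = {a..b}"
  by (simp add: \<nu>_def)

lemma nn_integral_\<nu>:
  assumes "f \<in> borel_measurable (lebesgue_on {a..b})"
  shows "(\<integral>\<^sup>+x. f x \<partial>\<nu>) = (\<integral>\<^sup>+x. ennreal (w x) * f x \<partial>lebesgue_on {a..b})"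
  unfolding \<nu>_def using assms by (intro nn_integral_density) auto

lemma AE_\<nu>_iff: "(AE x in \<nu>. P x) \<longleftrightarrow> (AE x in lebesgue_on {a..b}. P x)"
proof -
  have "(AE x in \<nu>. P x) \<longleftrightarrow> (AE x in lebesgue_on {a..b}. 0 < ennreal (w x) \<longrightarrow> P x)"
    unfolding \<nu>_def by (intro AE_density) measurable
  also have "\<dots> \<longleftrightarrow> (AE x in lebesgue_on {a..b}. P x)"
    using weight_pos by (intro AE_cong) auto
  finally show ?thesis .
qed

lemma finite_measure_lebesgue_on_interval: "finite_measure (lebesgue_on {a..b})"
  by (intro finite_measure_lebesgue_on) simp

lemma sigma_finite_\<nu>: "sigma_finite_measure \<nu>"
proof -
  interpret finite_measure "lebesgue_on {a..b}"
    by (rule finite_measure_lebesgue_on_interval)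
  show ?thesis
    unfolding \<nu>_def by (subst sigma_finite_iff_density_finite) auto
qed

section \<open>Convolution in an increasing coordinate\<close>

text \<open>The condition \<open>t \<le> x\<close> is expressed through \<open>\<phi>\<close>, so that the kernel is a Borel function of
  \<open>\<phi> x - \<phi> t\<close> and joint measurability reduces to the measurability of \<open>\<phi>\<close>.\<close>

definition convolution_kernel :: "real \<Rightarrow> real \<Rightarrow> real \<Rightarrow> real \<Rightarrow> ennreal" where
  "convolution_kernel \<sigma> \<mu> x t =
     ennreal (if \<phi> t \<le> \<phi> x then exp_powr_kernel \<sigma> \<mu> (\<phi> x - \<phi> t) else 0)"

lemma convolution_kernel_measurable [measurable]:
  "case_prod (convolution_kernel \<sigma> \<mu>) \<in> borel_measurable (\<nu> \<Otimes>\<^sub>M \<nu>)"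
  unfolding convolution_kernel_def by measurable

lemma convolution_kernel_measurable_section [measurable]:
  "convolution_kernel \<sigma> \<mu> x \<in> borel_measurable (lebesgue_on {a..b})"
  "(\<lambda>x. convolution_kernel \<sigma> \<mu> x t) \<in> borel_measurable (lebesgue_on {a..b})"
  unfolding convolution_kernel_def by measurable

text \<open>The substitution behind both marginals of the kernel: \<open>g\<close> is \<open>\<phi> x - \<phi> t\<close>, read as a function of \<open>t\<close>
  on \<open>[a,x]\<close> for the rows and as a function of \<open>x\<close> on \<open>[t,b]\<close> for the columns. Up to sign its
  derivative is the density of \<open>\<nu>\<close>, so the marginal is the mass of the kernel on \<open>[0,L]\<close>, which grows
  with \<open>L\<close>.\<close>

lemma nn_integral_kernel_substitution:
  assumes "0 < \<mu>" "0 \<le> \<sigma>" and S: "{x..y} \<subseteq> {a..b}" "x \<le> y"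
    and g: "\<And>z. z \<in> {x..y} \<Longrightarrow> (g has_real_derivative g' z) (at z within {x..y})"
    and g': "\<And>z. z \<in> {x..y} \<Longrightarrow> \<bar>g' z\<bar> = w z"
    and inj: "inj_on g {x..y}" and img: "g ` {x..y} = {0..L}" and L: "0 \<le> L" "L \<le> \<phi> b - \<phi> a"
    and k: "\<And>z. z \<in> {a..b} \<Longrightarrow>
      k z = (if z \<in> {x..y} then ennreal (exp_powr_kernel \<sigma> \<mu> (g z)) else 0)"
    and [measurable]: "k \<in> borel_measurable (lebesgue_on {a..b})"
  shows "(\<integral>\<^sup>+z. k z \<partial>\<nu>) \<le> ennreal (kernel_mass \<sigma> \<mu> (\<phi> b - \<phi> a))"
proof -
  have meas: "{x..y} \<in> sets lebesgue" "g ` {x..y} \<in> sets lebesgue"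
    by (auto simp: img)
  have int: "integrable (lebesgue_on (g ` {x..y})) (exp_powr_kernel \<sigma> \<mu>)"
    unfolding img using assms by (intro exp_powr_kernel_integrable)
  note subst = integral_substitution_lebesgue_on[OF meas g inj int]
  have "(\<integral>\<^sup>+z. k z \<partial>\<nu>) = (\<integral>\<^sup>+z. ennreal (w z) * k z \<partial>lebesgue_on {a..b})"
    by (intro nn_integral_\<nu>) measurable
  also have "\<dots> = (\<integral>\<^sup>+z. ennreal (\<bar>g' z\<bar> * exp_powr_kernel \<sigma> \<mu> (g z)) * indicator {x..y} z
      \<partial>lebesgue_on {a..b})"
    using g' k by (intro nn_integral_cong) (auto simp: ennreal_mult)
  also have "\<dots> = (\<integral>\<^sup>+z. ennreal (\<bar>g' z\<bar> * exp_powr_kernel \<sigma> \<mu> (g z)) \<partial>lebesgue_on {x..y})"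
    using S by (intro nn_integral_lebesgue_on_subset[symmetric]) auto
  also have "\<dots> = ennreal (LINT z|lebesgue_on {x..y}. \<bar>g' z\<bar> * exp_powr_kernel \<sigma> \<mu> (g z))"
    by (intro nn_integral_eq_integral subst) auto
  also have "\<dots> = ennreal (kernel_mass \<sigma> \<mu> L)"
    using subst(2) by (simp add: img kernel_mass_def)
  also have "\<dots> \<le> ennreal (kernel_mass \<sigma> \<mu> (\<phi> b - \<phi> a))"
    using assms by (intro ennreal_leI kernel_mass_mono) auto
  finally show ?thesis .
qed

lemma convolution_kernel_row:
  assumes "0 < \<mu>" "0 \<le> \<sigma>" and x: "x \<in> {a..b}"
  shows "(\<integral>\<^sup>+t. convolution_kernel \<sigma> \<mu> x t \<partial>\<nu>) \<le> ennreal (kernel_mass \<sigma> \<mu> (\<phi> b - \<phi> a))"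
proof (rule nn_integral_kernel_substitution[where x = a and y = x and g = "\<lambda>t. \<phi> x - \<phi> t"
      and g' = "\<lambda>t. - w t" and L = "\<phi> x - \<phi> a"])
  have sub: "{a..x} \<subseteq> {a..b}" and ax: "a \<in> {a..b}" "b \<in> {a..b}" "a \<le> x" using x less by auto
  show "((\<lambda>t. \<phi> x - \<phi> t) has_real_derivative - w z) (at z within {a..x})"
    if "z \<in> {a..x}" for z
    using DERIV_subset[OF deriv sub] that sub by (auto intro!: derivative_eq_intros)
  show "inj_on (\<lambda>t. \<phi> x - \<phi> t) {a..x}"
    using inj_on_subset[OF coordinate_inj sub] by (auto simp: inj_on_def)
  have "(\<lambda>t. \<phi> x - \<phi> t) ` {a..x} = (\<lambda>v. \<phi> x - v) ` (\<phi> ` {a..x})"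
    by (simp add: image_image)
  also have "\<dots> = {0..\<phi> x - \<phi> a}"
    using ax x by (subst coordinate_image) auto
  finally show "(\<lambda>t. \<phi> x - \<phi> t) ` {a..x} = {0..\<phi> x - \<phi> a}" .
  show "\<bar>- w z\<bar> = w z" if "z \<in> {a..x}" for z
    using weight_pos[of z] that sub by auto
  show "0 \<le> \<phi> x - \<phi> a" "\<phi> x - \<phi> a \<le> \<phi> b - \<phi> a"
    using x ax by (simp_all add: coordinate_le_iff)
  show "convolution_kernel \<sigma> \<mu> x z =
      (if z \<in> {a..x} then ennreal (exp_powr_kernel \<sigma> \<mu> (\<phi> x - \<phi> z)) else 0)" if "z \<in> {a..b}" for z
    using that x by (auto simp: convolution_kernel_def coordinate_le_iff)
qed (use assms in auto)

lemma convolution_kernel_column: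
  assumes "0 < \<mu>" "0 \<le> \<sigma>" and t: "t \<in> {a..b}"
  shows "(\<integral>\<^sup>+x. convolution_kernel \<sigma> \<mu> x t \<partial>\<nu>) \<le> ennreal (kernel_mass \<sigma> \<mu> (\<phi> b - \<phi> a))"
proof (rule nn_integral_kernel_substitution[where x = t and y = b and g = "\<lambda>x. \<phi> x - \<phi> t"
      and g' = w and L = "\<phi> b - \<phi> t"])
  have sub: "{t..b} \<subseteq> {a..b}" and ab: "a \<in> {a..b}" "b \<in> {a..b}" "t \<le> b" using t less by auto
  show "((\<lambda>x. \<phi> x - \<phi> t) has_real_derivative w z) (at z within {t..b})"
    if "z \<in> {t..b}" for z
    using DERIV_subset[OF deriv sub] that sub by (auto intro!: derivative_eq_intros)
  show "inj_on (\<lambda>x. \<phi> x - \<phi> t) {t..b}"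
    using inj_on_subset[OF coordinate_inj sub] by (auto simp: inj_on_def)
  have "(\<lambda>x. \<phi> x - \<phi> t) ` {t..b} = (\<lambda>v. v - \<phi> t) ` (\<phi> ` {t..b})"
    by (simp add: image_image)
  also have "\<dots> = {0..\<phi> b - \<phi> t}"
    using ab t by (subst coordinate_image) auto
  finally show "(\<lambda>x. \<phi> x - \<phi> t) ` {t..b} = {0..\<phi> b - \<phi> t}" .
  show "\<bar>w z\<bar> = w z" if "z \<in> {t..b}" for z
    using weight_pos[of z] that sub by auto
  show "0 \<le> \<phi> b - \<phi> t" "\<phi> b - \<phi> t \<le> \<phi> b - \<phi> a"
    using t ab by (simp_all add: coordinate_le_iff)
  show "convolution_kernel \<sigma> \<mu> z t =
      (if z \<in> {t..b} then ennreal (exp_powr_kernel \<sigma> \<mu> (\<phi> z - \<phi> t)) else 0)" if "z \<in> {a..b}" for z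
    using that t by (auto simp: convolution_kernel_def coordinate_le_iff)
qed (use assms in auto)

lemma convolution_Lp_bound:
  fixes F :: "real \<Rightarrow> real"
  assumes "0 < \<mu>" "0 \<le> \<sigma>" "1 \<le> q"
    and F: "F \<in> borel_measurable (lebesgue_on {a..b})" "\<And>t. 0 \<le> F t"
    and fin: "(\<integral>\<^sup>+t. ennreal (F t powr q) \<partial>\<nu>) < \<infinity>"
  shows "AE x in lebesgue_on {a..b}. (\<integral>\<^sup>+t. convolution_kernel \<sigma> \<mu> x t * ennreal (F t) \<partial>\<nu>) < \<infinity>"
    and "(\<integral>\<^sup>+x. ennreal (enn2real (\<integral>\<^sup>+t. convolution_kernel \<sigma> \<mu> x t * ennreal (F t) \<partial>\<nu>) powr q) \<partial>\<nu>)
      \<le> ennreal (kernel_mass \<sigma> \<mu> (\<phi> b - \<phi> a) powr q) * (\<integral>\<^sup>+t. ennreal (F t powr q) \<partial>\<nu>)"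
proof -
  interpret pair_sigma_finite \<nu> \<nu>
    by (intro pair_sigma_finite.intro sigma_finite_\<nu>)
  have F': "F \<in> borel_measurable \<nu>" using F(1) by simp
  have "0 < kernel_mass \<sigma> \<mu> (\<phi> b - \<phi> a)"
    using assms less by (intro kernel_mass_pos) (auto intro: coordinate_less)
  note schur = schur_test[OF convolution_kernel_measurable F' F(2) assms(3) this _ _ fin]
  show "AE x in lebesgue_on {a..b}. (\<integral>\<^sup>+t. convolution_kernel \<sigma> \<mu> x t * ennreal (F t) \<partial>\<nu>) < \<infinity>"
    unfolding AE_\<nu>_iff[symmetric] using assms
    by (intro schur convolution_kernel_row convolution_kernel_column) auto
  show "(\<integral>\<^sup>+x. ennreal (enn2real (\<integral>\<^sup>+t. convolution_kernel \<sigma> \<mu> x t * ennreal (F t) \<partial>\<nu>) powr q) \<partial>\<nu>)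
      \<le> ennreal (kernel_mass \<sigma> \<mu> (\<phi> b - \<phi> a) powr q) * (\<integral>\<^sup>+t. ennreal (F t powr q) \<partial>\<nu>)"
    using assms by (intro schur convolution_kernel_row convolution_kernel_column) auto
qed

lemma convolution_sup_bound:
  fixes F :: "real \<Rightarrow> real" and S :: ennreal
  assumes "0 < \<mu>" "0 \<le> \<sigma>" and x: "x \<in> {a..b}"
    and F: "AE t in lebesgue_on {a..b}. ennreal (F t) \<le> S"
  shows "(\<integral>\<^sup>+t. convolution_kernel \<sigma> \<mu> x t * ennreal (F t) \<partial>\<nu>)
      \<le> ennreal (kernel_mass \<sigma> \<mu> (\<phi> b - \<phi> a)) * S"
proof -
  have "(\<integral>\<^sup>+t. convolution_kernel \<sigma> \<mu> x t * ennreal (F t) \<partial>\<nu>)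
      \<le> (\<integral>\<^sup>+t. convolution_kernel \<sigma> \<mu> x t * S \<partial>\<nu>)"
    using F unfolding AE_\<nu>_iff[symmetric]
    by (intro nn_integral_mono_AE, elim eventually_mono) (rule mult_left_mono, auto)
  also have "\<dots> = (\<integral>\<^sup>+t. convolution_kernel \<sigma> \<mu> x t \<partial>\<nu>) * S"
    by (intro nn_integral_multc) measurable
  also have "\<dots> \<le> ennreal (kernel_mass \<sigma> \<mu> (\<phi> b - \<phi> a)) * S"
    using convolution_kernel_row[OF assms(1,2) x] by (intro mult_right_mono) auto
  finally show ?thesis .
qed

end

section \<open>Functions of class C1 on a closed interval\<close>

lemma C1_on_interval_deriv_on:
  assumes "C1_on_interval a b \<Psi>" "a < b"
  shows "\<And>x. x \<in> {a..b} \<Longrightarrow> (\<Psi> has_real_derivative deriv_on a b \<Psi> x) (at x within {a..b})"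
    and "continuous_on {a..b} (deriv_on a b \<Psi>)"
proof -
  obtain D where D: "\<And>x. x \<in> {a..b} \<Longrightarrow> (\<Psi> has_real_derivative D x) (at x within {a..b})"
    and cont: "continuous_on {a..b} D"
    using assms(1) unfolding C1_on_interval_def by blast
  have eq: "deriv_on a b \<Psi> x = D x" if "x \<in> {a..b}" for x
    unfolding deriv_on_def using D[OF that] assms(2) that
    by (intro vector_derivative_within_closed_interval)
       (simp_all add: has_real_derivative_iff_has_vector_derivative)
  show "(\<Psi> has_real_derivative deriv_on a b \<Psi> x) (at x within {a..b})" if "x \<in> {a..b}" for x
    using D[OF that] eq[OF that] by simp
  show "continuous_on {a..b} (deriv_on a b \<Psi>)"
    using cont eq by (subst continuous_on_cong[OF refl eq]) auto
qed

text \<open>All difference quotients of a monotone function are nonnegative.\<close>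

lemma mono_on_has_real_derivative_nonneg:
  fixes f :: "real \<Rightarrow> real"
  assumes "mono_on S f" "x \<in> S" "(f has_real_derivative d) (at x within S)" "at x within S \<noteq> bot"
  shows "0 \<le> d"
proof (rule tendsto_lowerbound[OF _ _ assms(4)])
  show "((\<lambda>y. (f y - f x) / (y - x)) \<longlongrightarrow> d) (at x within S)"
    using assms(3) by (simp add: has_field_derivative_iff)
  have "0 \<le> (f y - f x) / (y - x)" if "y \<in> S" for y
    using assms(1,2) that
    by (cases x y rule: linorder_cases) (auto simp: mono_on_def divide_nonpos_neg)
  then show "\<forall>\<^sub>F y in at x within S. 0 \<le> (f y - f x) / (y - x)"
    by (auto simp: eventually_at_filter)
qed

section \<open>The Hadamard-type integral operator\<close>

locale hadamard_setting =
  fixes \<Psi> :: "real \<Rightarrow> real" and a b \<mu> s c :: real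
  assumes order_pos: "0 < \<mu>" and interval: "a < b" and rate: "c \<le> s"
    and C1: "C1_on_interval a b \<Psi>"
    and pos: "\<And>x. x \<in> {a..b} \<Longrightarrow> 0 < \<Psi> x"
    and mono: "mono_on {a..b} \<Psi>"
    and deriv_nz: "\<And>x. x \<in> {a..b} \<Longrightarrow> deriv_on a b \<Psi> x \<noteq> 0"
begin

lemma deriv_on_pos: "0 < deriv_on a b \<Psi> x" if "x \<in> {a..b}"
proof -
  have "0 \<le> deriv_on a b \<Psi> x"
    using mono_on_has_real_derivative_nonneg[OF mono that C1_on_interval_deriv_on(1)[OF C1 interval that]]
      that interval by (simp add: trivial_limit_within islimpt_Icc)
  then show ?thesis using deriv_nz[OF that] by simp
qed

lemma \<Psi>_continuous: "continuous_on {a..b} \<Psi>"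
  using C1_on_interval_deriv_on(1)[OF C1 interval] by (rule DERIV_continuous_on)

sublocale increasing_coordinate "\<lambda>x. ln (\<Psi> x)" "\<lambda>x. deriv_on a b \<Psi> x / \<Psi> x" a b
proof
  show "((\<lambda>x. ln (\<Psi> x)) has_real_derivative deriv_on a b \<Psi> x / \<Psi> x) (at x within {a..b})"
    if "x \<in> {a..b}" for x
    using C1_on_interval_deriv_on(1)[OF C1 interval that] pos[OF that]
    by (auto intro!: derivative_eq_intros)
  show "continuous_on {a..b} (\<lambda>x. deriv_on a b \<Psi> x / \<Psi> x)"
    using pos by (intro continuous_on_divide C1_on_interval_deriv_on(2) C1 interval \<Psi>_continuous)
      (auto simp: less_le)
qed (use interval deriv_on_pos pos in auto)

lemma \<Psi>_measurable [measurable]: "\<Psi> \<in> borel_measurable (lebesgue_on {a..b})"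
  by (intro continuous_imp_measurable_on_sets_lebesgue \<Psi>_continuous) simp

lemma deriv_on_measurable [measurable]: "deriv_on a b \<Psi> \<in> borel_measurable (lebesgue_on {a..b})"
  using C1_on_interval_deriv_on(2)[OF C1 interval]
  by (intro continuous_imp_measurable_on_sets_lebesgue) simp_all

lemma \<Psi>_le_iff: "\<Psi> x \<le> \<Psi> y \<longleftrightarrow> x \<le> y" if "x \<in> {a..b}" "y \<in> {a..b}"
  using coordinate_le_iff[OF that] pos[OF that(1)] pos[OF that(2)] by simp

definition weighted_modulus :: "(real \<Rightarrow> complex) \<Rightarrow> real \<Rightarrow> real" where
  "weighted_modulus f t = \<Psi> t powr c * cmod (f t)"

lemma weighted_modulus_nonneg [simp]: "0 \<le> weighted_modulus f t"
  by (simp add: weighted_modulus_def)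

lemma weighted_modulus_measurable [measurable (raw)]:
  assumes [measurable]: "f \<in> borel_measurable (lebesgue_on {a..b})"
  shows "weighted_modulus f \<in> borel_measurable (lebesgue_on {a..b})"
  unfolding weighted_modulus_def by measurable

lemma X_norm_infinity:
  "X_norm \<Psi> c \<infinity> a b f = esssup (lebesgue_on {a..b}) (\<lambda>x. ennreal (weighted_modulus f x))"
  by (simp add: X_norm_def weighted_modulus_def)

text \<open>The \<open>X\<close> norm is the \<open>L\<^sup>q(\<nu>)\<close> norm of the weighted modulus.\<close>

lemma X_norm_finite_exponent:
  assumes "p \<noteq> \<infinity>" and f: "f \<in> borel_measurable (lebesgue_on {a..b})"
  defines "J \<equiv> \<integral>\<^sup>+x. ennreal (weighted_modulus f x powr enn2real p) \<partial>\<nu>"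
  shows "X_norm \<Psi> c p a b f =
    (if J = \<infinity> then \<infinity> else ennreal (enn2real J powr (1 / enn2real p)))"
proof -
  note [measurable] = f
  have "J = (\<integral>\<^sup>+x. ennreal (deriv_on a b \<Psi> x / \<Psi> x) * ennreal (weighted_modulus f x powr enn2real p)
      \<partial>lebesgue_on {a..b})"
    unfolding J_def by (intro nn_integral_\<nu>) measurable
  also have "\<dots> = (\<integral>\<^sup>+x. ennreal (cmod (complex_of_real (\<Psi> x powr c) * f x) powr enn2real p
      * (deriv_on a b \<Psi> x / \<Psi> x)) \<partial>lebesgue_on {a..b})"
    using weight_pos
    by (intro nn_integral_cong)
       (auto simp: weighted_modulus_def norm_mult ennreal_mult[symmetric] less_imp_le mult.commute)
  finally show ?thesis
    using assms(1) by (simp add: X_norm_def)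
qed

text \<open>Once multiplied by \<open>1 / Gamma \<mu>\<close>, this dominates the weighted modulus of the Hadamard integral of
  \<open>f\<close>. It is defined for every measurable \<open>f\<close>, and where it is finite the Hadamard integral converges
  absolutely.\<close>

abbreviation majorant :: "(real \<Rightarrow> complex) \<Rightarrow> real \<Rightarrow> ennreal" where
  "majorant f x \<equiv>
     \<integral>\<^sup>+t. convolution_kernel (s - c) \<mu> x t * ennreal (weighted_modulus f t) \<partial>\<nu>"

text \<open>With \<open>u = ln (\<Psi> x) - ln (\<Psi> t)\<close>, the identity behind this is
  \<open>\<Psi>(x)\<^sup>c (\<Psi>(t)/\<Psi>(x))\<^sup>s = exp(-(s-c)u) \<Psi>(t)\<^sup>c\<close>.\<close>

lemma norm_hadamard_integrand:
  assumes x: "x \<in> {a..b}" and t: "t \<in> {a..b}" "t \<le> x"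
  shows "ennreal (\<Psi> x powr c) * ennreal (cmod (hadamard_integrand \<Psi> a b \<mu> s f x t))
    = ennreal (deriv_on a b \<Psi> t / \<Psi> t)
      * (convolution_kernel (s - c) \<mu> x t * ennreal (weighted_modulus f t))"
proof -
  have px: "0 < \<Psi> x" and pt: "0 < \<Psi> t" and w: "0 < deriv_on a b \<Psi> t / \<Psi> t"
    and le: "ln (\<Psi> t) \<le> ln (\<Psi> x)"
    using assms pos weight_pos[OF t(1)] coordinate_le_iff by auto
  have "\<Psi> x powr c * (\<Psi> t / \<Psi> x) powr s = exp (- ((s - c) * (ln (\<Psi> x) - ln (\<Psi> t)))) * \<Psi> t powr c"
    using px pt by (simp add: powr_def ln_div mult_exp_exp algebra_simps)
  moreover have "\<Psi> x powr c * cmod (hadamard_integrand \<Psi> a b \<mu> s f x t)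
      = \<Psi> x powr c * (\<Psi> t / \<Psi> x) powr s
        * ((ln (\<Psi> x) - ln (\<Psi> t)) powr (\<mu> - 1) * cmod (f t) * (deriv_on a b \<Psi> t / \<Psi> t))"
    using px pt deriv_on_pos[OF t(1)]
    by (simp add: hadamard_integrand_def norm_mult norm_divide ln_div)
  ultimately have "\<Psi> x powr c * cmod (hadamard_integrand \<Psi> a b \<mu> s f x t)
      = deriv_on a b \<Psi> t / \<Psi> t
        * (exp_powr_kernel (s - c) \<mu> (ln (\<Psi> x) - ln (\<Psi> t)) * weighted_modulus f t)"
    by (simp add: exp_powr_kernel_def weighted_modulus_def)
  then show ?thesis
    using le w
    by (simp add: convolution_kernel_def ennreal_mult[symmetric] del: times_divide_eq_left)
qed

lemma hadamard_integrand_measurable: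
  assumes [measurable]: "f \<in> borel_measurable (lebesgue_on {a..b})" and x: "x \<in> {a..b}"
  shows "hadamard_integrand \<Psi> a b \<mu> s f x \<in> borel_measurable (lebesgue_on {a..x})"
proof -
  have "hadamard_integrand \<Psi> a b \<mu> s f x \<in> borel_measurable (lebesgue_on {a..b})"
    unfolding hadamard_integrand_def by measurable
  then show ?thesis
    by (rule measurable_restrict_mono) (use x in auto)
qed

lemma nn_integral_hadamard_integrand:
  assumes f[measurable]: "f \<in> borel_measurable (lebesgue_on {a..b})" and x: "x \<in> {a..b}"
  shows "ennreal (\<Psi> x powr c)
      * (\<integral>\<^sup>+t. ennreal (cmod (hadamard_integrand \<Psi> a b \<mu> s f x t)) \<partial>lebesgue_on {a..x})
    = majorant f x"
proof -
  note [measurable] = hadamard_integrand_measurable[OF f x]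
  have "ennreal (\<Psi> x powr c)
      * (\<integral>\<^sup>+t. ennreal (cmod (hadamard_integrand \<Psi> a b \<mu> s f x t)) \<partial>lebesgue_on {a..x})
    = (\<integral>\<^sup>+t. ennreal (\<Psi> x powr c) * ennreal (cmod (hadamard_integrand \<Psi> a b \<mu> s f x t))
      \<partial>lebesgue_on {a..x})"
    by (intro nn_integral_cmult[symmetric]) measurable
  also have "\<dots> = (\<integral>\<^sup>+t. ennreal (\<Psi> x powr c) * ennreal (cmod (hadamard_integrand \<Psi> a b \<mu> s f x t))
      * indicator {a..x} t \<partial>lebesgue_on {a..b})"
    using x by (intro nn_integral_lebesgue_on_subset) auto
  also have "\<dots> = (\<integral>\<^sup>+t. ennreal (deriv_on a b \<Psi> t / \<Psi> t)
      * (convolution_kernel (s - c) \<mu> x t * ennreal (weighted_modulus f t)) \<partial>lebesgue_on {a..b})"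
  proof (intro nn_integral_cong)
    fix t assume "t \<in> space (lebesgue_on {a..b})"
    then have t: "t \<in> {a..b}" by simp
    show "ennreal (\<Psi> x powr c) * ennreal (cmod (hadamard_integrand \<Psi> a b \<mu> s f x t))
        * indicator {a..x} t
      = ennreal (deriv_on a b \<Psi> t / \<Psi> t)
        * (convolution_kernel (s - c) \<mu> x t * ennreal (weighted_modulus f t))"
    proof (cases "t \<le> x")
      case True
      then show ?thesis using norm_hadamard_integrand[OF x t True] t by simp
    next
      case False
      then show ?thesis using coordinate_le_iff[OF t x] by (simp add: convolution_kernel_def)
    qed
  qed
  also have "\<dots> = majorant f x"
    by (intro nn_integral_\<nu>[symmetric]) measurable
  finally show ?thesis .
qed

lemma hadamard_integrand_integrable:
  assumes f: "f \<in> borel_measurable (lebesgue_on {a..b})" and x: "x \<in> {a..b}"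
    and fin: "majorant f x < \<infinity>"
  shows "integrable (lebesgue_on {a..x}) (hadamard_integrand \<Psi> a b \<mu> s f x)"
proof (rule integrableI_bounded[OF hadamard_integrand_measurable[OF f x]])
  show "(\<integral>\<^sup>+t. ennreal (cmod (hadamard_integrand \<Psi> a b \<mu> s f x t)) \<partial>lebesgue_on {a..x}) < \<infinity>"
    using fin pos[OF x]
    by (auto simp: nn_integral_hadamard_integrand[OF f x, symmetric] ennreal_mult_less_top)
qed

lemma weighted_modulus_hadamard_integral:
  assumes f: "f \<in> borel_measurable (lebesgue_on {a..b})" and x: "x \<in> {a..b}"
    and fin: "majorant f x < \<infinity>"
  shows "weighted_modulus (hadamard_integral \<Psi> a b \<mu> s f) x \<le> enn2real (majorant f x) / Gamma \<mu>"
proof -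
  have \<Gamma>: "0 < Gamma \<mu>" using order_pos by (rule Gamma_real_pos)
  let ?I = "LINT t|lebesgue_on {a..x}. hadamard_integrand \<Psi> a b \<mu> s f x t"
  have "ennreal (\<Psi> x powr c * cmod ?I) = ennreal (\<Psi> x powr c) * ennreal (cmod ?I)"
    by (simp add: ennreal_mult)
  also have "\<dots> \<le> majorant f x"
    unfolding nn_integral_hadamard_integrand[OF f x, symmetric]
    by (intro mult_left_mono integral_norm_bound_ennreal hadamard_integrand_integrable f x fin) simp
  finally have le: "ennreal (\<Psi> x powr c * cmod ?I) \<le> majorant f x" .
  have "\<Psi> x powr c * cmod ?I \<le> enn2real (majorant f x)"
    using enn2real_mono[OF le] fin by simp
  then show ?thesis
    using \<Gamma> by (simp add: weighted_modulus_def hadamard_integral_def norm_mult norm_divide divide_right_mono)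
qed

text \<open>The domain of integration depends on \<open>x\<close>. Moving it into the integrand as the condition \<open>\<Psi> t \<le> \<Psi> x\<close>
  turns the operator into an integral with a jointly measurable integrand over a fixed space.\<close>

lemma hadamard_integral_measurable:
  assumes [measurable]: "f \<in> borel_measurable (lebesgue_on {a..b})"
  shows "hadamard_integral \<Psi> a b \<mu> s f \<in> borel_measurable (lebesgue_on {a..b})"
proof -
  interpret finite_measure "lebesgue_on {a..b}"
    by (rule finite_measure_lebesgue_on_interval)
  let ?H = "\<lambda>x. complex_of_real (1 / Gamma \<mu>) * (LINT t|lebesgue_on {a..b}.
    (if \<Psi> t \<le> \<Psi> x then hadamard_integrand \<Psi> a b \<mu> s f x t else 0))"
  have "?H \<in> borel_measurable (lebesgue_on {a..b})"
    unfolding hadamard_integrand_def by measurable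
  moreover have "hadamard_integral \<Psi> a b \<mu> s f x = ?H x" if x: "x \<in> {a..b}" for x
  proof -
    have eq: "lebesgue_on {a..x} = restrict_space (lebesgue_on {a..b}) {a..x}"
      using x by (subst restrict_restrict_space) (auto simp: Int_absorb1)
    have "(LINT t|lebesgue_on {a..x}. hadamard_integrand \<Psi> a b \<mu> s f x t)
        = (LINT t|lebesgue_on {a..b}. indicator {a..x} t *\<^sub>R hadamard_integrand \<Psi> a b \<mu> s f x t)"
      unfolding eq using x by (intro integral_restrict_space) (auto simp: sets_restrict_space_iff)
    also have "\<dots> = (LINT t|lebesgue_on {a..b}.
        (if \<Psi> t \<le> \<Psi> x then hadamard_integrand \<Psi> a b \<mu> s f x t else 0))"
      using x by (intro Bochner_Integration.integral_cong) (auto simp: \<Psi>_le_iff)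
    finally show ?thesis by (simp add: hadamard_integral_def)
  qed
  ultimately show ?thesis
    by (subst measurable_cong[where g = ?H]) auto
qed

lemma hadamard_const_eq:
  "hadamard_const \<Psi> a b \<mu> s c = kernel_mass (s - c) \<mu> (ln (\<Psi> b) - ln (\<Psi> a)) / Gamma \<mu>"
proof -
  have "0 < \<Psi> a" "0 < \<Psi> b" "\<Psi> a \<le> \<Psi> b"
    using pos interval mono by (auto simp: mono_on_def)
  then show ?thesis
    using order_pos rate by (subst hadamard_const_eq_kernel_mass) (auto simp: ln_div)
qed

lemma hadamard_const_nonneg: "0 \<le> hadamard_const \<Psi> a b \<mu> s c"
  using kernel_mass_pos[of \<mu> "s - c" "ln (\<Psi> b) - ln (\<Psi> a)"] coordinate_less[of a b]
    order_pos rate interval by (simp add: hadamard_const_eq Gamma_real_pos less_imp_le)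

lemma hadamard_integral_bound_sup:
  assumes f: "f \<in> X_space \<Psi> c \<infinity> a b"
  shows "AE x in lebesgue_on {a..b}. majorant f x < \<infinity>"
    and "X_norm \<Psi> c \<infinity> a b (hadamard_integral \<Psi> a b \<mu> s f)
      \<le> ennreal (hadamard_const \<Psi> a b \<mu> s c) * X_norm \<Psi> c \<infinity> a b f"
proof -
  define S where "S = X_norm \<Psi> c \<infinity> a b f"
  define C where "C = kernel_mass (s - c) \<mu> (ln (\<Psi> b) - ln (\<Psi> a))"
  have meas: "f \<in> borel_measurable (lebesgue_on {a..b})" and "S < \<infinity>"
    using f by (auto simp: X_space_def S_def)
  have "AE t in lebesgue_on {a..b}. ennreal (weighted_modulus f t) \<le> S"
    unfolding S_def X_norm_infinity by (rule esssup_AE)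
  then have bound: "majorant f x \<le> ennreal C * S" if "x \<in> {a..b}" for x
    unfolding C_def using order_pos rate that by (intro convolution_sup_bound) auto
  also have finS: "ennreal C * S < \<infinity>"
    using \<open>S < \<infinity>\<close> by (simp add: ennreal_mult_less_top)
  finally have fin: "majorant f x < \<infinity>" if "x \<in> {a..b}" for x
    using that .
  then show "AE x in lebesgue_on {a..b}. majorant f x < \<infinity>" by (intro AE_I2) simp
  have "ennreal (weighted_modulus (hadamard_integral \<Psi> a b \<mu> s f) x)
      \<le> ennreal (hadamard_const \<Psi> a b \<mu> s c) * S" if x: "x \<in> {a..b}" for x
  proof -
    have "ennreal (weighted_modulus (hadamard_integral \<Psi> a b \<mu> s f) x)
        \<le> ennreal (1 / Gamma \<mu> * enn2real (majorant f x))"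
      using weighted_modulus_hadamard_integral[OF meas x fin[OF x]] by (intro ennreal_leI) simp
    also have "\<dots> = ennreal (1 / Gamma \<mu>) * majorant f x"
      using fin[OF x] order_pos
      by (subst ennreal_mult) (auto simp: Gamma_real_pos less_imp_le ennreal_enn2real)
    also have "\<dots> \<le> ennreal (1 / Gamma \<mu>) * (ennreal C * S)"
      using bound[OF x] by (intro mult_left_mono) auto
    also have "\<dots> = ennreal (hadamard_const \<Psi> a b \<mu> s c) * S"
      using order_pos
      by (simp add: hadamard_const_eq C_def mult.assoc[symmetric] ennreal_mult'[symmetric] Gamma_real_pos less_imp_le)
    finally show ?thesis .
  qed
  then show "X_norm \<Psi> c \<infinity> a b (hadamard_integral \<Psi> a b \<mu> s f)
      \<le> ennreal (hadamard_const \<Psi> a b \<mu> s c) * X_norm \<Psi> c \<infinity> a b f"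
    unfolding X_norm_infinity[of "hadamard_integral \<Psi> a b \<mu> s f"] S_def[symmetric]
    using weighted_modulus_measurable[OF hadamard_integral_measurable[OF meas]]
    by (intro esssup_I AE_I2) auto
qed

text \<open>The convolution bound is one on \<open>q\<close>-th powers: \<open>J\<close> is the \<open>q\<close>-th power of the norm whenever
  it is finite, and the constant enters as \<open>(C / Gamma \<mu>) powr q\<close>.\<close>

lemma hadamard_integral_bound_Lp:
  assumes p: "1 \<le> p" "p \<noteq> \<infinity>" and f: "f \<in> X_space \<Psi> c p a b"
  shows "AE x in lebesgue_on {a..b}. majorant f x < \<infinity>"
    and "X_norm \<Psi> c p a b (hadamard_integral \<Psi> a b \<mu> s f)
      \<le> ennreal (hadamard_const \<Psi> a b \<mu> s c) * X_norm \<Psi> c p a b f"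
proof -
  define q where "q = enn2real p"
  define C where "C = kernel_mass (s - c) \<mu> (ln (\<Psi> b) - ln (\<Psi> a))"
  define K where "K = hadamard_const \<Psi> a b \<mu> s c"
  define J where "J g = (\<integral>\<^sup>+x. ennreal (weighted_modulus g x powr q) \<partial>\<nu>)" for g
  let ?I = "hadamard_integral \<Psi> a b \<mu> s f"
  have q: "1 \<le> q"
    using p enn2real_mono[of 1 p] by (simp add: q_def less_top)
  have meas: "f \<in> borel_measurable (lebesgue_on {a..b})" and "X_norm \<Psi> c p a b f < \<infinity>"
    using f by (auto simp: X_space_def)
  have norm_eq: "X_norm \<Psi> c p a b g
      = (if J g = \<infinity> then \<infinity> else ennreal (enn2real (J g) powr (1 / q)))"
    if "g \<in> borel_measurable (lebesgue_on {a..b})" for g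
    using X_norm_finite_exponent[OF p(2) that] by (simp add: J_def q_def)
  have J_fin: "J f < \<infinity>"
    using \<open>X_norm \<Psi> c p a b f < \<infinity>\<close> by (auto simp: norm_eq[OF meas] less_top split: if_splits)
  have \<Gamma>: "0 < Gamma \<mu>" using order_pos by (rule Gamma_real_pos)
  have K: "K = C / Gamma \<mu>" "0 \<le> K"
    using hadamard_const_nonneg by (simp_all add: K_def C_def hadamard_const_eq)
  then have C: "0 \<le> C" using \<Gamma> by (simp add: zero_le_divide_iff)
  note conv = convolution_Lp_bound[OF order_pos _ q weighted_modulus_measurable[OF meas]
      weighted_modulus_nonneg J_fin[unfolded J_def], of "s - c", folded C_def]
  show fin: "AE x in lebesgue_on {a..b}. majorant f x < \<infinity>"
    using rate by (intro conv) simp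
  have [measurable]: "majorant f \<in> borel_measurable \<nu>"
  proof -
    interpret sigma_finite_measure \<nu> by (rule sigma_finite_\<nu>)
    have [measurable]: "weighted_modulus f \<in> borel_measurable \<nu>"
      using weighted_modulus_measurable[OF meas] by simp
    show ?thesis by measurable
  qed
  have "J ?I \<le> (\<integral>\<^sup>+x. ennreal (Gamma \<mu> powr (- q)) * ennreal (enn2real (majorant f x) powr q) \<partial>\<nu>)"
    unfolding J_def
  proof (rule nn_integral_mono_AE)
    have "AE x in \<nu>. x \<in> {a..b}" using AE_space[of \<nu>] by simp
    moreover have "AE x in \<nu>. majorant f x < \<infinity>" using fin by (simp add: AE_\<nu>_iff)
    ultimately show "AE x in \<nu>. ennreal (weighted_modulus ?I x powr q)
        \<le> ennreal (Gamma \<mu> powr (- q)) * ennreal (enn2real (majorant f x) powr q)"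
    proof eventually_elim
      case (elim x)
      have "weighted_modulus ?I x powr q \<le> (enn2real (majorant f x) / Gamma \<mu>) powr q"
        using q by (intro powr_mono2 weighted_modulus_hadamard_integral meas elim) auto
      also have "\<dots> = Gamma \<mu> powr (- q) * enn2real (majorant f x) powr q"
        using \<Gamma> by (simp add: powr_divide powr_minus_divide)
      finally show ?case
        by (simp add: ennreal_mult[symmetric])
    qed
  qed
  also have "\<dots> = ennreal (Gamma \<mu> powr (- q)) * (\<integral>\<^sup>+x. ennreal (enn2real (majorant f x) powr q) \<partial>\<nu>)"
    by (intro nn_integral_cmult) measurable
  also have "\<dots> \<le> ennreal (Gamma \<mu> powr (- q)) * (ennreal (C powr q) * J f)"
    using conv(2) rate by (intro mult_left_mono) (auto simp: J_def)
  also have "\<dots> = ennreal (K powr q) * J f"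
    using \<Gamma> C by (simp add: K mult.assoc[symmetric] ennreal_mult[symmetric] powr_divide powr_minus_divide)
  finally have J_le: "J ?I \<le> ennreal (K powr q) * J f" .
  also have J_fin': "ennreal (K powr q) * J f < \<infinity>"
    using J_fin by (simp add: ennreal_mult_less_top)
  finally have "J ?I < \<infinity>" .
  have "enn2real (J ?I) powr (1 / q) \<le> (K powr q * enn2real (J f)) powr (1 / q)"
    using enn2real_mono[OF J_le] J_fin' q
    by (intro powr_mono2) (auto simp: enn2real_mult enn2real_nonneg)
  also have "\<dots> = K * enn2real (J f) powr (1 / q)"
    using K(2) q by (simp add: powr_mult powr_powr enn2real_nonneg)
  finally have "ennreal (enn2real (J ?I) powr (1 / q)) \<le> ennreal K * ennreal (enn2real (J f) powr (1 / q))"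
    using K(2) by (simp add: ennreal_mult[symmetric])
  then show "X_norm \<Psi> c p a b ?I \<le> ennreal (hadamard_const \<Psi> a b \<mu> s c) * X_norm \<Psi> c p a b f"
    using less_imp_neq[OF J_fin] less_imp_neq[OF \<open>J ?I < \<infinity>\<close>]
    by (simp add: norm_eq[OF meas] norm_eq[OF hadamard_integral_measurable[OF meas]] K_def)
qed

lemma hadamard_integral_bounded:
  assumes p: "1 \<le> p" and f: "f \<in> X_space \<Psi> c p a b"
  shows "AE x in lebesgue_on {a..b}.
      integrable (lebesgue_on {a..x}) (hadamard_integrand \<Psi> a b \<mu> s f x)"
    and "hadamard_integral \<Psi> a b \<mu> s f \<in> X_space \<Psi> c p a b"
    and "X_norm \<Psi> c p a b (hadamard_integral \<Psi> a b \<mu> s f)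
      \<le> ennreal (hadamard_const \<Psi> a b \<mu> s c) * X_norm \<Psi> c p a b f"
proof -
  have meas: "f \<in> borel_measurable (lebesgue_on {a..b})" and fin: "X_norm \<Psi> c p a b f < \<infinity>"
    using f by (auto simp: X_space_def)
  have majorant: "AE x in lebesgue_on {a..b}. majorant f x < \<infinity>"
    using hadamard_integral_bound_sup(1)[of f] hadamard_integral_bound_Lp(1)[OF p _ f] f
    by (cases "p = \<infinity>") auto
  moreover have "AE x in lebesgue_on {a..b}. x \<in> {a..b}"
    by (intro AE_I2) simp
  ultimately show "AE x in lebesgue_on {a..b}.
      integrable (lebesgue_on {a..x}) (hadamard_integrand \<Psi> a b \<mu> s f x)"
    by eventually_elim (rule hadamard_integrand_integrable[OF meas])
  show bound: "X_norm \<Psi> c p a b (hadamard_integral \<Psi> a b \<mu> s f)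
      \<le> ennreal (hadamard_const \<Psi> a b \<mu> s c) * X_norm \<Psi> c p a b f"
    using hadamard_integral_bound_sup(2)[of f] hadamard_integral_bound_Lp(2)[OF p _ f] f
    by (cases "p = \<infinity>") auto
  also have "\<dots> < \<infinity>" using fin by (simp add: ennreal_mult_less_top)
  finally show "hadamard_integral \<Psi> a b \<mu> s f \<in> X_space \<Psi> c p a b"
    using hadamard_integral_measurable[OF meas] by (simp add: X_space_def)
qed

end

theorem theorem4p2:
  fixes \<Psi> :: "real \<Rightarrow> real" and \<mu> a b s c :: real and p :: ennreal
  assumes "\<mu> > 0" and "1 \<le> p" and "a < b" and "c \<le> s"
    and "C1_on_interval a b \<Psi>"
    and "\<forall>x\<in>{a..b}. \<Psi> x > 0"
    and "mono_on {a..b} \<Psi>"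
    and "\<forall>x\<in>{a..b}. deriv_on a b \<Psi> x \<noteq> 0"
  shows "\<forall>f \<in> X_space \<Psi> c p a b.
    (AE x in lebesgue_on {a..b}.
       integrable (lebesgue_on {a..x}) (hadamard_integrand \<Psi> a b \<mu> s f x)) \<and>
    hadamard_integral \<Psi> a b \<mu> s f \<in> X_space \<Psi> c p a b \<and>
    X_norm \<Psi> c p a b (hadamard_integral \<Psi> a b \<mu> s f)
      \<le> ennreal (hadamard_const \<Psi> a b \<mu> s c) * X_norm \<Psi> c p a b f"
proof -
  interpret hadamard_setting \<Psi> a b \<mu> s c
    using assms by unfold_locales auto
  show ?thesis
    using hadamard_integral_bounded[OF \<open>1 \<le> p\<close>] by blast
qed

end
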